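(* For every integer $k\ge0$, all $P,Q\in\mathcal{P}$ and all $t\in[0,1]$, with $R(t)=(Q-P)t+P$, $$\mathrm{SL}_k(P\|R(t))=\Psi^k[\mathrm{SL}_0](P\|R(t)).$$ For every $k\ge1$, $\mathrm{SL}_k$ is a right-convex divergence, and $\{\mathrm{SL}_k(P\|R(t))\}_{k\ge0}$ is a monotonically decreasing (i.e. non-increasing in $k$) sequence.
   Context: $(\Sigma,\mathcal{M})$ is a measurable space and $\mathcal{P}$ is a set of probability distributions (measures) on it with common support, containing with $P,Q$ every mixture $R(t):=(Q-P)t+P$, $t\in[0,1]$. $p,q$ denote the Radon-Nikodym derivatives of $P,Q$ with respect to a positive measure $\mu$ (e.g. Lebesgue or counting measure), and integrals are over the common support (where $p,q>0$). A divergence is a function $D:\mathcal{P}\times\mathcal{P}\to[0,\infty]$ such that, for all $P,Q\in\mathcal{P}$, $D(P\|Q)\ge 0$, and $D(P\|Q)=0$ if and only if $P=Q$. It is right-convex if it is convex in the second argument: $\lambda D(P\|Q_1)+(1-\lambda)D(P\|Q_2)\ge D(P\|\lambda Q_1+(1-\lambda)Q_2)$ for all $P,Q_1,Q_2\in\mathcal{P}$ and $\lambda\in[0,1]$. Integral operator: when $\frac1t D(P\|R(t))$ is integrable on $[0,1]$ (Lebesgue measure), define $\Psi[D](P\|R(t)):=\int_0^t\frac1s D(P\|R(s))\,ds$. The right-hand side depends only on $P$ and the distribution $R(t)$, so $\Psi[D]$ is a well-defined function on $\mathcal{P}\times\mathcal{P}$; equivalently, $\Psi[D](P\|Q)=\int_0^1\frac1s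 D(P\|(Q-P)s+P)\,ds$. Iterates: $\Psi^0$ is the identity operator and $\Psi^{k+1}:=\Psi\circ\Psi^k$ for $k\ge0$. Polylogarithm: for $k>0$, $\mathrm{Li}_k(z):=\frac{z}{\Gamma(k)}\int_0^\infty\frac{x^{k-1}}{e^x-z}\,dx$ (used here for real $z<1$). For $k\ge1$, $\mathrm{PL}_k(P\|Q):=\int p\,\mathrm{Li}_k\left(1-\frac{q}{p}\right)d\mu$. $\mathrm{KL}(P\|Q):=\int p\log\frac{p}{q}\,d\mu$ (natural logarithm) is the Kullback-Leibler divergence and $\mathrm{J}(P,Q):=\mathrm{KL}(P\|Q)+\mathrm{KL}(Q\|P)$ is the Jeffreys divergence. $\mathrm{SL}_k:\mathcal{P}\times\mathcal{P}\to\mathbb{R}$ is defined by $\mathrm{SL}_0(P\|Q):=\mathrm{J}(P,Q)$ and, for $k\ge1$, $\mathrm{SL}_k(P\|Q):=\mathrm{J}(P,Q)-\sum_{j=1}^k\mathrm{PL}_j(P\|Q)$; these functions are real-valued, i.e. $\mathrm{J}$ and the $\mathrm{PL}_j$ ($j\geq 1$) are assumed finite on $\mathcal{P}\times\mathcal{P}$. *)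

theory Defs
  imports "HOL-Probability.Probability"
begin

text \<open>The mixture \<open>R(t) = (Q - P) t + P\<close>; meaningful for \<open>t \<in> [0,1]\<close> and \<open>sets Q = sets P\<close>.\<close>

definition mixture :: "'a measure \<Rightarrow> 'a measure \<Rightarrow> real \<Rightarrow> 'a measure" where
  "mixture P Q t = measure_of (space P) (sets P)
     (\<lambda>A. ennreal (1 - t) * emeasure P A + ennreal t * emeasure Q A)"

lemma sets_mixture [simp]: "sets (mixture P Q t) = sets P"
  and space_mixture [simp]: "space (mixture P Q t) = space P"
  by (simp_all add: mixture_def)

lemma emeasure_mixture:
  assumes "sets Q = sets P" "A \<in> sets P"
  shows "emeasure (mixture P Q t) A = ennreal (1 - t) * emeasure P A + ennreal t * emeasure Q A"
  unfolding mixture_def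
proof (rule emeasure_measure_of_sigma[OF _ _ _ assms(2)])
  show "sigma_algebra (space P) (sets P)" ..
  show "positive (sets P) (\<lambda>A. ennreal (1 - t) * emeasure P A + ennreal t * emeasure Q A)"
    by (simp add: positive_def)
  show "countably_additive (sets P) (\<lambda>A. ennreal (1 - t) * emeasure P A + ennreal t * emeasure Q A)"
  proof (rule countably_additiveI)
    fix A :: "nat \<Rightarrow> _"
    assume A: "range A \<subseteq> sets P" "disjoint_family A" "(\<Union>i. A i) \<in> sets P"
    have "(\<Sum>i. ennreal (1 - t) * emeasure P (A i) + ennreal t * emeasure Q (A i))
        = ennreal (1 - t) * (\<Sum>i. emeasure P (A i)) + ennreal t * (\<Sum>i. emeasure Q (A i))"
      by (subst suminf_add[symmetric]) (auto intro: summableI)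
    also have "\<dots> = ennreal (1 - t) * emeasure P (\<Union>i. A i) + ennreal t * emeasure Q (\<Union>i. A i)"
      using A assms(1) by (simp add: suminf_emeasure)
    finally show "(\<Sum>i. ennreal (1 - t) * emeasure P (A i) + ennreal t * emeasure Q (A i))
        = ennreal (1 - t) * emeasure P (\<Union>i. A i) + ennreal t * emeasure Q (\<Union>i. A i)" .
  qed
qed

lemma mixture_mixture:
  assumes "sets Q = sets P" "s \<in> {0..1}" "t \<in> {0..1}"
  shows "mixture P (mixture P Q t) s = mixture P Q (t * s)"
proof (rule measure_eqI)
  fix A assume "A \<in> sets (mixture P (mixture P Q t) s)"
  then have A: "A \<in> sets P" by simp
  have "t * s \<le> 1" using assms by (simp add: mult_le_one)
  have "ennreal (1 - s) + ennreal s * ennreal (1 - t) = ennreal ((1 - s) + s * (1 - t))"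
    using assms by (simp add: ennreal_plus ennreal_mult)
  also have "(1 - s) + s * (1 - t) = 1 - t * s" by (simp add: algebra_simps)
  finally have c: "ennreal (1 - s) + ennreal s * ennreal (1 - t) = ennreal (1 - t * s)" .
  have d: "ennreal (t * s) = ennreal s * ennreal t"
    using assms by (simp add: ennreal_mult mult.commute)
  show "emeasure (mixture P (mixture P Q t) s) A = emeasure (mixture P Q (t * s)) A"
    using assms A
    by (simp add: emeasure_mixture d flip: c) (simp add: algebra_simps)
qed simp

definition divergence :: "'a measure set \<Rightarrow> ('a measure \<Rightarrow> 'a measure \<Rightarrow> ereal) \<Rightarrow> bool" where
  "divergence \<P> D \<longleftrightarrow>
     (\<forall>P\<in>\<P>. \<forall>Q\<in>\<P>. D P Q \<ge> 0 \<and> (D P Q = 0 \<longleftrightarrow> P = Q))"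

definition right_convex :: "'a measure set \<Rightarrow> ('a measure \<Rightarrow> 'a measure \<Rightarrow> ereal) \<Rightarrow> bool" where
  "right_convex \<P> D \<longleftrightarrow>
     (\<forall>P\<in>\<P>. \<forall>Q1\<in>\<P>. \<forall>Q2\<in>\<P>. \<forall>l\<in>{0..1::real}.
        ereal l * D P Q1 + ereal (1 - l) * D P Q2 \<ge> D P (mixture Q2 Q1 l))"

definition Psi_integrable ::
    "('a measure \<Rightarrow> 'a measure \<Rightarrow> real) \<Rightarrow> 'a measure \<Rightarrow> 'a measure \<Rightarrow> bool" where
  "Psi_integrable D P Q \<longleftrightarrow> set_integrable lborel {0..1} (\<lambda>s. 1 / s * D P (mixture P Q s))"

definition Psi ::
    "('a measure \<Rightarrow> 'a measure \<Rightarrow> real) \<Rightarrow> 'a measure \<Rightarrow> 'a measure \<Rightarrow> real" where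
  "Psi D P Q = (LBINT s:{0..1}. 1 / s * D P (mixture P Q s))"

lemma Psi_mixture:
  assumes "sets Q = sets P" "t \<in> {0<..1}"
  shows "Psi D P (mixture P Q t) = (LBINT s:{0..t}. 1 / s * D P (mixture P Q s))"
proof -
  let ?f = "\<lambda>s. indicator {0..t} s * (1 / s * D P (mixture P Q s))"
  have t: "0 < t" "t \<le> 1" using assms by auto
  have "(LBINT s:{0..t}. 1 / s * D P (mixture P Q s)) = (\<integral>s. ?f s \<partial>lborel)"
    by (simp add: set_lebesgue_integral_def)
  also have "\<dots> = t * (\<integral>s. ?f (t * s) \<partial>lborel)"
    using lborel_integral_real_affine[of t ?f 0] t by simp
  also have "\<dots> = (\<integral>s. t * ?f (t * s) \<partial>lborel)"
    by (rule integral_mult_right_zero[symmetric])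
  also have "\<dots> = (\<integral>s. indicator {0..1} s * (1 / s * D P (mixture P (mixture P Q t) s)) \<partial>lborel)"
  proof (rule Bochner_Integration.integral_cong[OF refl])
    fix s :: real
    show "t * ?f (t * s) = indicator {0..1} s * (1 / s * D P (mixture P (mixture P Q t) s))"
      using t assms mixture_mixture[of Q P s t]
      by (auto simp: indicator_def zero_le_mult_iff)
  qed
  also have "\<dots> = Psi D P (mixture P Q t)"
    by (simp add: Psi_def set_lebesgue_integral_def)
  finally show ?thesis ..
qed

definition dens :: "'a measure \<Rightarrow> 'a measure \<Rightarrow> 'a \<Rightarrow> real" where
  "dens \<mu> P x = enn2real (RN_deriv \<mu> P x)"

definition supp :: "'a measure \<Rightarrow> 'a measure \<Rightarrow> 'a set" where
  "supp \<mu> P = {x \<in> space \<mu>. dens \<mu> P x > 0}"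

definition KL_integrand :: "'a measure \<Rightarrow> 'a measure \<Rightarrow> 'a measure \<Rightarrow> 'a \<Rightarrow> real" where
  "KL_integrand \<mu> P Q x = dens \<mu> P x * ln (dens \<mu> P x / dens \<mu> Q x)"

definition KL :: "'a measure \<Rightarrow> 'a measure \<Rightarrow> 'a measure \<Rightarrow> real" where
  "KL \<mu> P Q = (LINT x:supp \<mu> P \<inter> supp \<mu> Q|\<mu>. KL_integrand \<mu> P Q x)"

definition Jeffreys :: "'a measure \<Rightarrow> 'a measure \<Rightarrow> 'a measure \<Rightarrow> real" where
  "Jeffreys \<mu> P Q = KL \<mu> P Q + KL \<mu> Q P"

definition Li :: "real \<Rightarrow> real \<Rightarrow> real" where
  "Li k z = z / Gamma k * (LBINT x:{0<..}. x powr (k - 1) / (exp x - z))"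

definition PL_integrand :: "'a measure \<Rightarrow> nat \<Rightarrow> 'a measure \<Rightarrow> 'a measure \<Rightarrow> 'a \<Rightarrow> real" where
  "PL_integrand \<mu> k P Q x = dens \<mu> P x * Li (real k) (1 - dens \<mu> Q x / dens \<mu> P x)"

definition PL :: "'a measure \<Rightarrow> nat \<Rightarrow> 'a measure \<Rightarrow> 'a measure \<Rightarrow> real" where
  "PL \<mu> k P Q = (LINT x:supp \<mu> P \<inter> supp \<mu> Q|\<mu>. PL_integrand \<mu> k P Q x)"

definition SL :: "'a measure \<Rightarrow> nat \<Rightarrow> 'a measure \<Rightarrow> 'a measure \<Rightarrow> real" where
  "SL \<mu> k P Q = Jeffreys \<mu> P Q - (\<Sum>j=1..k. PL \<mu> j P Q)"

text \<open>
  Agreement with the library's \<^const>\<open>KL_divergence\<close>, whose measure arguments come in the opposite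
  order and whose first argument is the base of the logarithm.
\<close>

lemma density_dens:
  assumes "sigma_finite_measure \<mu>" "prob_space P" "absolutely_continuous \<mu> P" "sets P = sets \<mu>"
  shows "P = density \<mu> (\<lambda>x. ennreal (dens \<mu> P x))"
proof -
  interpret sigma_finite_measure \<mu> by fact
  interpret P: prob_space P by fact
  have "AE x in \<mu>. RN_deriv \<mu> P x \<noteq> \<infinity>"
    by (rule RN_deriv_finite) (use assms P.sigma_finite_measure_axioms in auto)
  then have "density \<mu> (\<lambda>x. ennreal (dens \<mu> P x)) = density \<mu> (RN_deriv \<mu> P)"
    by (intro density_cong) (auto simp: dens_def top.not_eq_extremum)
  also have "\<dots> = P" using assms by (intro density_RN_deriv) auto
  finally show ?thesis ..
qed

lemma KL_eq_KL_divergence: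
  assumes "sigma_finite_measure \<mu>"
    and P: "prob_space P" "absolutely_continuous \<mu> P" "sets P = sets \<mu>"
    and Q: "prob_space Q" "absolutely_continuous \<mu> Q" "sets Q = sets \<mu>"
    and supp: "AE x in \<mu>. x \<in> supp \<mu> P \<longleftrightarrow> x \<in> supp \<mu> Q"
  shows "KL \<mu> P Q = KL_divergence (exp 1) Q P"
proof -
  interpret sigma_finite_measure \<mu> by fact
  have [measurable]: "dens \<mu> P \<in> borel_measurable \<mu>" "dens \<mu> Q \<in> borel_measurable \<mu>"
    by (auto simp: dens_def[abs_def])
  have nn: "0 \<le> dens \<mu> N x" for N x by (simp add: dens_def)
  have "KL_divergence (exp 1) Q P
      = KL_divergence (exp 1) (density \<mu> (dens \<mu> Q)) (density \<mu> (dens \<mu> P))"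
    using density_dens[OF assms(1) P] density_dens[OF assms(1) Q] by simp
  also have "\<dots> = (\<integral>x. dens \<mu> P x * log (exp 1) (dens \<mu> P x / dens \<mu> Q x) \<partial>\<mu>)"
  proof (rule KL_density_density)
    show "AE x in \<mu>. dens \<mu> Q x = 0 \<longrightarrow> dens \<mu> P x = 0"
      using supp AE_space
    proof eventually_elim
      case (elim x)
      then show ?case using nn[of P x] by (auto simp: supp_def)
    qed
  qed (auto simp: nn)
  also have "\<dots> = KL \<mu> P Q"
    unfolding KL_def set_lebesgue_integral_def KL_integrand_def
  proof (rule integral_cong_AE)
    show "AE x in \<mu>. dens \<mu> P x * log (exp 1) (dens \<mu> P x / dens \<mu> Q x)
        = indicator (supp \<mu> P \<inter> supp \<mu> Q) x *\<^sub>R (dens \<mu> P x * ln (dens \<mu> P x / dens \<mu> Q x))"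
      using supp AE_space
    proof eventually_elim
      case (elim x)
      then show ?case using nn[of P x] by (auto simp: supp_def indicator_def log_def)
    qed
  qed (auto simp: supp_def)
  finally show ?thesis ..
qed

end

theory Submission
  imports Defs
begin

text \<open>
  Each \<open>SL\<^sub>k\<close> is an \<open>f\<close>-divergence, and \<open>\<Psi>\<close> acts on \<open>f\<close>-divergences through their generators.
  Put \<open>u = q / p\<close>. Since \<open>1 + s (u - 1)\<close> is the density ratio of the mixture \<open>R(s)\<close> to \<open>P\<close>,
  Fubini's theorem shows that \<open>\<Psi>\<close> sends the divergence \<open>\<integral> \<phi>(u) dP\<close> to \<open>\<integral> (T \<phi>)(u) dP\<close>, where
  \<open>(T \<phi>)(u) = \<integral>\<^sub>0\<^sup>1 \<phi>(1 + s (u - 1)) / s ds\<close>.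

  The operator \<open>T\<close> raises the order of a polylogarithm: \<open>Li\<^sub>k(1 - u)\<close> goes to \<open>Li\<^sub>k\<^sub>+\<^sub>1(1 - u)\<close>
  (\<open>Li_ray_integral\<close>). It fixes \<open>u - 1\<close>, and it sends the Jeffreys generator \<open>(u - 1) ln u\<close> to
  \<open>u ln u - (u - 1)\<close>, which equals \<open>(u - 1) ln u - Li\<^sub>1(1 - u) - (u - 1)\<close> because
  \<open>Li\<^sub>1(1 - u) = - ln u\<close>. Hence the functions
  \<open>\<psi>\<^sub>k(u) = (u - 1) ln u - \<Sum>\<^sub>j\<^sub>\<le>\<^sub>k Li\<^sub>j(1 - u) - k (u - 1)\<close>
  satisfy \<open>T \<psi>\<^sub>k = \<psi>\<^sub>k\<^sub>+\<^sub>1\<close> (\<open>generator_ray_integral\<close>). They represent \<open>SL\<^sub>k\<close>, because \<open>u - 1\<close> has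
  \<open>P\<close>-integral \<open>0\<close>. The correction \<open>- k (u - 1)\<close> is what makes the functions pointwise nonnegative,
  so that Tonelli's theorem applies and no cancellation has to be controlled.

  The other claims are properties of \<open>\<psi>\<^sub>k\<close> that \<open>T\<close> preserves. The function
  \<open>\<psi>\<^sub>0(u) = (u - 1) ln u\<close> is convex, nonnegative, and zero only at \<open>u = 1\<close>; \<open>T\<close> averages the functions
  \<open>\<psi>(1 + s (u - 1)) / s\<close>, which inherit these properties. Convexity together with \<open>\<psi>(1) = 0\<close> gives
  \<open>\<psi>(1 + s (u - 1)) \<le> s \<psi>(u)\<close>, hence \<open>T \<psi> \<le> \<psi>\<close>, which is monotonicity in \<open>k\<close>.
\<close>

section \<open>Polylogarithms along a ray\<close>

text \<open>
  This is \<open>Li\<^sub>k\<^sub>+\<^sub>1(z) / z\<close> for \<open>z < 1\<close>, with the value \<open>1\<close> at \<open>z = 0\<close>. The sign of the polylogarithm sits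
  entirely in the factor \<open>z\<close>, so that the quotient can be taken in the extended nonnegative reals and
  integrals can be interchanged before finiteness is known.
\<close>

definition polylog_moment :: "nat \<Rightarrow> real \<Rightarrow> ennreal" where
  "polylog_moment k z =
     (\<integral>\<^sup>+x. ennreal (x ^ k / fact k / (exp x - z)) * indicator {0..} x \<partial>lborel)"

lemma mult_unit_less_one:
  fixes s z :: real
  assumes "z < 1" "s \<in> {0..1}"
  shows "s * z < 1"
proof (cases "z \<le> 0")
  case True
  then have "s * z \<le> 0" using assms by (simp add: mult_nonneg_nonpos)
  then show ?thesis by simp
next
  case False
  then have "s * z \<le> 1 * z" using assms by (intro mult_right_mono) auto
  then show ?thesis using assms by simp
qed

text \<open>
  The substitution \<open>s = exp (x - v)\<close> turns averaging over \<open>s \<in> [0,1]\<close> into integration over the tail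
  \<open>v \<ge> x\<close>. Both sides are evaluated by the fundamental theorem of calculus; the common closed form
  also supplies the order-one polylogarithm.
\<close>

lemma nn_integral_scale_eq_tail:
  assumes "0 \<le> x" "z < 1"
  shows "(\<integral>\<^sup>+s. ennreal (1 / (exp x - s * z)) * indicator {0..1} s \<partial>lborel) =
         (\<integral>\<^sup>+v. ennreal (1 / (exp v - z)) * indicator {x..} v \<partial>lborel)"
    and "(\<integral>\<^sup>+v. ennreal (1 / (exp v - z)) * indicator {x..} v \<partial>lborel) =
         ennreal (if z = 0 then exp (- x) else - ln (1 - z * exp (- x)) / z)"
proof -
  have pos_s: "exp x - s * z > 0" if "s \<in> {0..1}" for s
    using mult_unit_less_one[OF assms(2) that] assms(1) one_le_exp_iff[of x] by linarith
  have pos_v: "exp v - z > 0" if "x \<le> v" for v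
    using assms that one_le_exp_iff[of v] by linarith
  have pos_w: "1 - z * exp (- v) > 0" if "x \<le> v" for v
    using pos_v[OF that] by (simp add: exp_minus field_simps)
  show tail: "(\<integral>\<^sup>+v. ennreal (1 / (exp v - z)) * indicator {x..} v \<partial>lborel) =
         ennreal (if z = 0 then exp (- x) else - ln (1 - z * exp (- x)) / z)"
  proof (cases "z = 0")
    case True
    have "(\<integral>\<^sup>+v. ennreal (exp (- v)) * indicator {x..} v \<partial>lborel) = ennreal (0 - (- exp (- x)))"
    proof (rule nn_integral_FTC_atLeast)
      show "((\<lambda>v. - exp (- v :: real)) \<longlongrightarrow> 0) at_top" by real_asymp
    qed (auto intro!: derivative_eq_intros)
    then show ?thesis using True by (simp add: exp_minus inverse_eq_divide)
  next
    case False
    have "(\<integral>\<^sup>+v. ennreal (1 / (exp v - z)) * indicator {x..} v \<partial>lborel)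
        = ennreal (0 - ln (1 - z * exp (- x)) / z)"
    proof (rule nn_integral_FTC_atLeast)
      fix v assume "x \<le> v"
      from pos_w[OF this] pos_v[OF this] show "DERIV (\<lambda>v. ln (1 - z * exp (- v)) / z) v :> 1 / (exp v - z)"
        using False by (auto intro!: derivative_eq_intros simp: exp_minus field_simps)
    next
      have "((\<lambda>v. ln (1 - z * exp (- v)) / z) \<longlongrightarrow> ln (1 - z * 0) / z) at_top"
        by (intro tendsto_intros filterlim_compose[OF exp_at_bot] filterlim_uminus_at_bot_at_top) (use False in auto)
      then show "((\<lambda>v. ln (1 - z * exp (- v)) / z) \<longlongrightarrow> 0) at_top" by simp
    qed (use pos_v in \<open>auto intro!: less_imp_le\<close>)
    then show ?thesis using False by simp
  qed
  show "(\<integral>\<^sup>+s. ennreal (1 / (exp x - s * z)) * indicator {0..1} s \<partial>lborel) =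
         (\<integral>\<^sup>+v. ennreal (1 / (exp v - z)) * indicator {x..} v \<partial>lborel)"
  proof (cases "z = 0")
    case True
    have "(\<integral>\<^sup>+s. ennreal (exp (- x)) * indicator {0..1::real} s \<partial>lborel) = ennreal (exp (- x))"
      by (simp add: nn_integral_cmult)
    then show ?thesis unfolding tail using True by (simp add: exp_minus inverse_eq_divide)
  next
    case False
    have "(\<integral>\<^sup>+s. ennreal (1 / (exp x - s * z)) * indicator {0..1} s \<partial>lborel)
       = ennreal (- ln (exp x - 1 * z) / z - (- ln (exp x - 0 * z) / z))"
    proof (rule nn_integral_FTC_Icc)
      fix s :: real assume "s \<in> {0..1}"
      from pos_s[OF this] show "DERIV (\<lambda>s. - ln (exp x - s * z) / z) s :> 1 / (exp x - s * z)"
        using False by (auto intro!: derivative_eq_intros)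
    qed (use pos_s in \<open>auto intro!: less_imp_le\<close>)
    also have "- ln (exp x - 1 * z) / z - (- ln (exp x - 0 * z) / z) = - ln (1 - z * exp (- x)) / z"
    proof -
      have "ln (1 - z * exp (- x)) = ln ((exp x - z) * exp (- x))" by (simp add: exp_minus field_simps)
      also have "\<dots> = ln (exp x - z) - x" using pos_v[of x] by (subst ln_mult) auto
      finally show ?thesis by (simp add: diff_divide_distrib)
    qed
    finally show ?thesis unfolding tail using False by simp
  qed
qed

lemma nn_integral_power_Icc:
  assumes "0 \<le> v"
  shows "(\<integral>\<^sup>+x. ennreal (x ^ k / fact k) * indicator {0..v} x \<partial>lborel) = ennreal (v ^ Suc k / fact (Suc k))"
proof -
  have "(\<integral>\<^sup>+x. ennreal (x ^ k / fact k) * indicator {0..v} x \<partial>lborel) = ennreal (v ^ Suc k / fact (Suc k) - 0 ^ Suc k / fact (Suc k))"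
  proof (rule nn_integral_FTC_Icc)
    show "((\<lambda>x. x ^ Suc k / fact (Suc k)) has_real_derivative x ^ k / fact k) (at x)" for x
      by (auto intro!: derivative_eq_intros simp: divide_simps simp del: power_Suc)
  qed (use assms in auto)
  then show ?thesis by simp
qed

text \<open>
  By the tail identity the left side is the integral of \<open>x\<^sup>k / k! / (exp v - z)\<close> over
  \<open>0 \<le> x \<le> v\<close>; performing the integration in \<open>x\<close> first gives \<open>v\<^sup>k\<^sup>+\<^sup>1 / (k + 1)!\<close>.
\<close>

lemma nn_integral_polylog_moment:
  assumes "z < 1"
  shows "(\<integral>\<^sup>+s. polylog_moment k (s * z) * indicator {0..1} s \<partial>lborel) = polylog_moment (Suc k) z"
proof -
  have pos: "0 < exp x - s * z" if "0 \<le> x" "s \<in> {0..1}" for s x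
    using mult_unit_less_one[OF assms that(2)] that(1) one_le_exp_iff[of x] by linarith
  have pos': "0 < exp v - z" if "0 \<le> v" for v
    using pos[of v 1] that by simp
  have "(\<integral>\<^sup>+s. polylog_moment k (s * z) * indicator {0..1} s \<partial>lborel)
      = (\<integral>\<^sup>+s. (\<integral>\<^sup>+x. ennreal (x ^ k / fact k) * indicator {0..} x *
            (ennreal (1 / (exp x - s * z)) * indicator {0..1} s) \<partial>lborel) \<partial>lborel)"
    unfolding polylog_moment_def
  proof (intro nn_integral_cong)
    fix s :: real
    have "(\<integral>\<^sup>+x. ennreal (x ^ k / fact k / (exp x - s * z)) * indicator {0..} x \<partial>lborel) * indicator {0..1} s
       = (\<integral>\<^sup>+x. ennreal (x ^ k / fact k / (exp x - s * z)) * indicator {0..} x * indicator {0..1} s \<partial>lborel)"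
      by (rule nn_integral_multc[symmetric]) auto
    also have "\<dots> = (\<integral>\<^sup>+x. ennreal (x ^ k / fact k) * indicator {0..} x *
            (ennreal (1 / (exp x - s * z)) * indicator {0..1} s) \<partial>lborel)"
      using pos[of _ s]
      by (intro nn_integral_cong) (auto simp: indicator_def simp flip: ennreal_mult')
    finally show "(\<integral>\<^sup>+x. ennreal (x ^ k / fact k / (exp x - s * z)) * indicator {0..} x \<partial>lborel) * indicator {0..1} s
       = (\<integral>\<^sup>+x. ennreal (x ^ k / fact k) * indicator {0..} x *
            (ennreal (1 / (exp x - s * z)) * indicator {0..1} s) \<partial>lborel)" .
  qed
  also have "\<dots> = (\<integral>\<^sup>+x. (\<integral>\<^sup>+s. ennreal (x ^ k / fact k) * indicator {0..} x *
            (ennreal (1 / (exp x - s * z)) * indicator {0..1} s) \<partial>lborel) \<partial>lborel)"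
    by (rule lborel_pair.Fubini') measurable
  also have "\<dots> = (\<integral>\<^sup>+x. (\<integral>\<^sup>+v. ennreal (x ^ k / fact k) * indicator {0..} x *
            (ennreal (1 / (exp v - z)) * (if x \<le> v then 1 else 0)) \<partial>lborel) \<partial>lborel)"
  proof (rule nn_integral_cong)
    fix x :: real
    show "(\<integral>\<^sup>+s. ennreal (x ^ k / fact k) * indicator {0..} x *
            (ennreal (1 / (exp x - s * z)) * indicator {0..1} s) \<partial>lborel) =
          (\<integral>\<^sup>+v. ennreal (x ^ k / fact k) * indicator {0..} x *
            (ennreal (1 / (exp v - z)) * (if x \<le> v then 1 else 0)) \<partial>lborel)"
      using nn_integral_scale_eq_tail(1)[of x z] assms
      by (cases "0 \<le> x") (simp_all add: nn_integral_cmult indicator_def of_bool_def)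
  qed
  also have "\<dots> = (\<integral>\<^sup>+v. (\<integral>\<^sup>+x. ennreal (x ^ k / fact k) * indicator {0..} x *
            (ennreal (1 / (exp v - z)) * (if x \<le> v then 1 else 0)) \<partial>lborel) \<partial>lborel)"
    by (rule lborel_pair.Fubini') measurable
  also have "\<dots> = polylog_moment (Suc k) z"
    unfolding polylog_moment_def
  proof (intro nn_integral_cong)
    fix v :: real
    have "(\<integral>\<^sup>+x. ennreal (x ^ k / fact k) * indicator {0..} x *
            (ennreal (1 / (exp v - z)) * (if x \<le> v then 1 else 0)) \<partial>lborel)
       = (\<integral>\<^sup>+x. ennreal (x ^ k / fact k) * indicator {0..v} x * ennreal (1 / (exp v - z)) \<partial>lborel)"
      by (intro nn_integral_cong) (auto simp: indicator_def)
    also have "\<dots> = (\<integral>\<^sup>+x. ennreal (x ^ k / fact k) * indicator {0..v} x \<partial>lborel) * ennreal (1 / (exp v - z))"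
      by (rule nn_integral_multc) auto
    also have "\<dots> = ennreal (v ^ Suc k / fact (Suc k) / (exp v - z)) * indicator {0..} v"
      using nn_integral_power_Icc[of v k] pos'[of v]
      by (cases "0 \<le> v") (simp_all flip: ennreal_mult')
    finally show "(\<integral>\<^sup>+x. ennreal (x ^ k / fact k) * indicator {0..} x *
            (ennreal (1 / (exp v - z)) * (if x \<le> v then 1 else 0)) \<partial>lborel)
       = ennreal (v ^ Suc k / fact (Suc k) / (exp v - z)) * indicator {0..} v" .
  qed
  finally show ?thesis .
qed

lemma polylog_moment_mono:
  assumes "z \<le> z'" "z' < 1"
  shows "polylog_moment k z \<le> polylog_moment k z'"
  unfolding polylog_moment_def
proof (intro nn_integral_mono)
  fix x :: real
  show "ennreal (x ^ k / fact k / (exp x - z)) * indicator {0..} x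
      \<le> ennreal (x ^ k / fact k / (exp x - z')) * indicator {0..} x"
  proof (cases "0 \<le> x")
    case True
    then have "0 < exp x - z'" using assms one_le_exp_iff[of x] by linarith
    then show ?thesis using True assms by (auto intro!: ennreal_leI divide_left_mono mult_pos_pos)
  qed auto
qed

lemma polylog_moment_0:
  assumes "z < 1"
  shows "polylog_moment 0 z = ennreal (if z = 0 then 1 else - ln (1 - z) / z)"
  using nn_integral_scale_eq_tail(2)[of 0 z] assms by (simp add: polylog_moment_def)

text \<open>
  For \<open>k = 0\<close> the closed form is finite. The averages that define the next order are bounded by the
  value at the larger end of the segment from \<open>0\<close> to \<open>z\<close>, because the integrand increases with \<open>z\<close>.
\<close>

lemma polylog_moment_finite: "z < 1 \<Longrightarrow> polylog_moment k z < \<infinity>"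
proof (induction k arbitrary: z)
  case 0
  then show ?case by (simp add: polylog_moment_0)
next
  case (Suc k)
  have "polylog_moment (Suc k) z = (\<integral>\<^sup>+s. polylog_moment k (s * z) * indicator {0..1} s \<partial>lborel)"
    using nn_integral_polylog_moment[OF Suc.prems] by simp
  also have "\<dots> \<le> (\<integral>\<^sup>+s. polylog_moment k (max z 0) * indicator {0..1::real} s \<partial>lborel)"
  proof (intro nn_integral_mono)
    fix s :: real
    have "s * z \<le> max z 0" if "s \<in> {0..1}"
    proof (cases "z \<le> 0")
      case True then show ?thesis using that by (simp add: mult_nonneg_nonpos max_def)
    next
      case False then show ?thesis using that by (simp add: mult_left_le_one_le)
    qed
    then show "polylog_moment k (s * z) * indicator {0..1} s \<le> polylog_moment k (max z 0) * indicator {0..1} s"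
      using Suc.prems by (auto simp: indicator_def intro!: polylog_moment_mono)
  qed
  also have "\<dots> = polylog_moment k (max z 0)" by (simp add: nn_integral_cmult)
  also have "\<dots> < \<infinity>" using Suc by simp
  finally show ?case .
qed

lemma Li_eq_polylog_moment:
  assumes "z < 1"
  shows "Li (real (Suc k)) z = z * enn2real (polylog_moment k z)"
proof -
  have pos: "0 < exp x - z" if "0 < x" for x
    using assms that one_less_exp_iff[of x] by linarith
  have "(LBINT x:{0<..}. x powr (real (Suc k) - 1) / (exp x - z))
      = (LBINT x. fact k * (x ^ k / fact k / (exp x - z) * indicator {0<..} x))"
    unfolding set_lebesgue_integral_def
    by (intro Bochner_Integration.integral_cong) (auto simp: indicator_def powr_realpow)
  also have "\<dots> = fact k * (LBINT x. x ^ k / fact k / (exp x - z) * indicator {0<..} x)"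
    by (rule integral_mult_right_zero)
  also have "(LBINT x. x ^ k / fact k / (exp x - z) * indicator {0<..} x)
      = enn2real (\<integral>\<^sup>+x. ennreal (x ^ k / fact k / (exp x - z) * indicator {0<..} x) \<partial>lborel)"
    by (rule integral_eq_nn_integral) (use pos in \<open>auto intro!: AE_I2 divide_nonneg_pos mult_pos_pos simp: indicator_def\<close>)
  also have "(\<integral>\<^sup>+x. ennreal (x ^ k / fact k / (exp x - z) * indicator {0<..} x) \<partial>lborel) = polylog_moment k z"
    unfolding polylog_moment_def
  proof (intro nn_integral_cong_AE)
    show "AE x in lborel. ennreal (x ^ k / fact k / (exp x - z) * indicator {0<..} x) =
       ennreal (x ^ k / fact k / (exp x - z)) * indicator {0..} x"
      using AE_lborel_singleton[of "0::real"] by eventually_elim (auto simp: indicator_def)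
  qed
  finally show ?thesis
    using Gamma_fact[of k, where 'a = real] by (simp add: Li_def add.commute)
qed

lemma Li_1: "z < 1 \<Longrightarrow> Li 1 z = - ln (1 - z)"
  using Li_eq_polylog_moment[of z 0] polylog_moment_0[of z]
  by (auto simp: enn2real_ennreal divide_simps)

lemma borel_measurable_Li [measurable]: "Li k \<in> borel_measurable borel"
  unfolding Li_def[abs_def] set_lebesgue_integral_def by measurable

lemma borel_measurable_polylog_moment [measurable]: "polylog_moment k \<in> borel_measurable borel"
  unfolding polylog_moment_def[abs_def] by measurable

text \<open>
  The integral form of \<open>z Li\<^sub>k\<^sub>+\<^sub>1'(z) = Li\<^sub>k(z)\<close>. The integrand agrees with \<open>z\<close> times the previous
  nonnegative quantity except at \<open>s = 0\<close>, where division by zero makes it vanish.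
\<close>

lemma Li_ray_integral:
  assumes "z < 1"
  shows "has_bochner_integral lborel (\<lambda>s. indicator {0..1} s * (1 / s * Li (real (Suc k)) (s * z)))
           (Li (real (Suc (Suc k))) z)"
proof -
  have "has_bochner_integral lborel (\<lambda>s. indicator {0..1} s * enn2real (polylog_moment k (s * z)))
          (enn2real (polylog_moment (Suc k) z))"
  proof (rule has_bochner_integral_nn_integral)
    have "(\<integral>\<^sup>+s. ennreal (indicator {0..1} s * enn2real (polylog_moment k (s * z))) \<partial>lborel)
        = (\<integral>\<^sup>+s. polylog_moment k (s * z) * indicator {0..1} s \<partial>lborel)"
      using polylog_moment_finite mult_unit_less_one[OF assms]
      by (intro nn_integral_cong) (auto simp: indicator_def)
    then show "(\<integral>\<^sup>+s. ennreal (indicator {0..1} s * enn2real (polylog_moment k (s * z))) \<partial>lborel)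
        = ennreal (enn2real (polylog_moment (Suc k) z))"
      using assms polylog_moment_finite[of z "Suc k"] by (simp add: nn_integral_polylog_moment)
  qed auto
  then have "has_bochner_integral lborel (\<lambda>s. z * (indicator {0..1} s * enn2real (polylog_moment k (s * z))))
          (z * enn2real (polylog_moment (Suc k) z))"
    by (rule has_bochner_integral_mult_right)
  moreover have "has_bochner_integral lborel (\<lambda>s. z * (indicator {0..1} s * enn2real (polylog_moment k (s * z))))
          (z * enn2real (polylog_moment (Suc k) z)) \<longleftrightarrow>
     has_bochner_integral lborel (\<lambda>s. indicator {0..1} s * (1 / s * Li (real (Suc k)) (s * z)))
          (z * enn2real (polylog_moment (Suc k) z))"
  proof (rule has_bochner_integral_cong_AE)
    show "AE s in lborel. z * (indicator {0..1} s * enn2real (polylog_moment k (s * z))) =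
       indicator {0..1} s * (1 / s * Li (real (Suc k)) (s * z))"
      using AE_lborel_singleton[of "0::real"]
      by eventually_elim
         (use mult_unit_less_one[OF assms] in \<open>auto simp: indicator_def Li_eq_polylog_moment simp del: of_nat_Suc\<close>)
  qed auto
  ultimately show ?thesis
    using Li_eq_polylog_moment[OF assms, of "Suc k"] by simp
qed

section \<open>The generators\<close>

text \<open>
  The subtracted multiple of \<open>u - 1\<close> does not change the divergence, since \<open>q / p - 1\<close> has
  \<open>P\<close>-mean zero. Its coefficient \<open>k\<close> makes \<open>1\<close> a zero of order two, hence the minimum.
\<close>

definition generator :: "nat \<Rightarrow> real \<Rightarrow> real" where
  "generator k u = (u - 1) * ln u - (\<Sum>j=1..k. Li (real j) (1 - u)) - real k * (u - 1)"

lemma borel_measurable_generator [measurable]: "generator k \<in> borel_measurable borel"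
  unfolding generator_def[abs_def] by measurable

lemma generator_1 [simp]: "generator k 1 = 0"
  by (simp add: generator_def Li_def)

lemma ray_pos:
  fixes u :: real
  assumes "0 < u" "s \<in> {0..1}"
  shows "0 < 1 + s * (u - 1)"
  using mult_unit_less_one[of "1 - u" s] assms by (simp add: algebra_simps)

text \<open>
  The image of the Jeffreys generator \<open>(u - 1) ln u\<close>: at \<open>1 + s (u - 1)\<close> the factor \<open>s\<close> cancels
  against \<open>1 / s\<close>.
\<close>

lemma log_ray_integral:
  fixes u :: real
  assumes "0 < u"
  shows "has_bochner_integral lborel (\<lambda>s. indicator {0..1} s * ((u - 1) * ln (1 + s * (u - 1))))
           (u * ln u - (u - 1))"
proof -
  define F where "F s = (1 + s * (u - 1)) * ln (1 + s * (u - 1)) - s * (u - 1)" for s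
  have "has_bochner_integral lborel (\<lambda>s. (u - 1) * ln (1 + s * (u - 1)) * indicator {0..1} s) (F 1 - F 0)"
  proof (rule has_bochner_integral_FTC_Icc_nonneg)
    fix s :: real assume s: "s \<in> {0..1}"
    have "DERIV F s :> (u - 1) * ln (1 + s * (u - 1)) +
        (1 + s * (u - 1)) * ((u - 1) / (1 + s * (u - 1))) - (u - 1)"
      unfolding F_def[abs_def] using ray_pos[OF assms s] by (auto intro!: derivative_eq_intros)
    then show "DERIV F s :> (u - 1) * ln (1 + s * (u - 1))"
      using ray_pos[OF assms s] by simp
    show "0 \<le> (u - 1) * ln (1 + s * (u - 1))"
      using s ray_pos[OF assms s]
      by (cases "1 \<le> u") (auto intro!: mult_nonneg_nonneg mult_nonpos_nonpos ln_ge_zero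
          simp: ln_le_zero_iff mult_nonneg_nonpos)
  qed auto
  then show ?thesis by (simp add: F_def mult.commute)
qed

text \<open>
  The polylogarithm of order \<open>j\<close> moves to order \<open>j + 1\<close>. The missing summand of order \<open>1\<close>, which is
  \<open>- ln u\<close>, and one further copy of \<open>u - 1\<close> come from the Jeffreys term.
\<close>

lemma generator_ray_integral:
  assumes "0 < u"
  shows "has_bochner_integral lborel (\<lambda>s. indicator {0..1} s * (1 / s * generator k (1 + s * (u - 1))))
           (generator (Suc k) u)"
proof -
  let ?I = "\<lambda>s::real. indicator {0..1::real} s :: real"
  have "has_bochner_integral lborel
     (\<lambda>s. ?I s * ((u - 1) * ln (1 + s * (u - 1)))
        - (\<Sum>j=1..k. ?I s * (1 / s * Li (real j) (s * (1 - u))))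
        - ?I s * (real k * (u - 1)))
     ((u * ln u - (u - 1)) - (\<Sum>j=1..k. Li (real (Suc j)) (1 - u)) - real k * (u - 1))"
  proof (intro has_bochner_integral_diff has_bochner_integral_sum log_ray_integral assms)
    fix j assume "j \<in> {1..k}"
    then show "has_bochner_integral lborel (\<lambda>s. ?I s * (1 / s * Li (real j) (s * (1 - u)))) (Li (real (Suc j)) (1 - u))"
      using Li_ray_integral[of "1 - u" "j - 1"] assms by simp
  next
    have "has_bochner_integral lborel (\<lambda>s. ?I s *\<^sub>R (real k * (u - 1))) (measure lborel {0..1::real} *\<^sub>R (real k * (u - 1)))"
      by (intro has_bochner_integral_scaleR_left has_bochner_integral_real_indicator) auto
    then show "has_bochner_integral lborel (\<lambda>s. ?I s * (real k * (u - 1))) (real k * (u - 1))"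
      by simp
  qed
  moreover have "(u * ln u - (u - 1)) - (\<Sum>j=1..k. Li (real (Suc j)) (1 - u)) - real k * (u - 1)
      = generator (Suc k) u"
  proof -
    have "(\<Sum>j=1..Suc k. Li (real j) (1 - u)) = Li 1 (1 - u) + (\<Sum>j=1..k. Li (real (Suc j)) (1 - u))"
      by (subst sum.atLeast_Suc_atMost) (simp_all add: sum.atLeast_Suc_atMost_Suc_shift del: sum.cl_ivl_Suc)
    then show ?thesis
      using Li_1[of "1 - u"] assms unfolding generator_def by (simp add: algebra_simps)
  qed
  moreover have "has_bochner_integral lborel
     (\<lambda>s. ?I s * ((u - 1) * ln (1 + s * (u - 1)))
        - (\<Sum>j=1..k. ?I s * (1 / s * Li (real j) (s * (1 - u))))
        - ?I s * (real k * (u - 1))) x \<longleftrightarrow>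
     has_bochner_integral lborel (\<lambda>s. ?I s * (1 / s * generator k (1 + s * (u - 1)))) x" for x
  proof (rule has_bochner_integral_cong_AE)
    show "AE s in lborel. ?I s * ((u - 1) * ln (1 + s * (u - 1)))
        - (\<Sum>j=1..k. ?I s * (1 / s * Li (real j) (s * (1 - u))))
        - ?I s * (real k * (u - 1)) = ?I s * (1 / s * generator k (1 + s * (u - 1)))"
      using AE_lborel_singleton[of "0::real"]
    proof eventually_elim
      case (elim s)
      have "1 - (1 + s * (u - 1)) = s * (1 - u)" by (simp add: algebra_simps)
      then have "generator k (1 + s * (u - 1)) =
          s * (u - 1) * ln (1 + s * (u - 1)) - (\<Sum>j=1..k. Li (real j) (s * (1 - u))) - real k * (s * (u - 1))"
        by (simp add: generator_def)
      moreover have "1 / s * (s * w * a - b - c * (s * w)) = w * a - 1 / s * b - c * w" for w a b c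
        using elim by (simp add: field_simps)
      ultimately have "1 / s * generator k (1 + s * (u - 1)) =
          (u - 1) * ln (1 + s * (u - 1)) - (\<Sum>j=1..k. 1 / s * Li (real j) (s * (1 - u))) - real k * (u - 1)"
        by (simp only: sum_distrib_left)
      then show ?case by (simp only: right_diff_distrib sum_distrib_left)
    qed
  qed auto
  ultimately show ?thesis by simp
qed

lemma generator_0_pos:
  assumes "0 < u" "u \<noteq> 1"
  shows "0 < generator 0 u"
proof (cases "u < 1")
  case True
  then show ?thesis using assms mult_neg_neg[of "u - 1" "ln u"] by (simp add: generator_def)
next
  case False
  then show ?thesis using assms mult_pos_pos[of "u - 1" "ln u"] by (simp add: generator_def)
qed

text \<open>
  Both halves are proved in one induction: the integrand of the next order is nonnegative, and for
  \<open>u \<noteq> 1\<close> it is positive on the whole of \<open>(0,1]\<close>, so its integral cannot vanish.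
\<close>

lemma generator_nonneg_pos:
  assumes "0 < u"
  shows "0 \<le> generator k u \<and> (u \<noteq> 1 \<longrightarrow> 0 < generator k u)"
  using assms
proof (induction k arbitrary: u)
  case 0
  then show ?case using generator_0_pos[of u] by (cases "u = 1") auto
next
  case (Suc k)
  let ?f = "\<lambda>s. indicator {0..1} s * (1 / s * generator k (1 + s * (u - 1)))"
  have int: "integrable lborel ?f" "generator (Suc k) u = (LBINT s. ?f s)"
    using generator_ray_integral[OF Suc.prems, of k] by (auto simp: has_bochner_integral_iff)
  have nn: "0 \<le> ?f s" for s
    using Suc.IH[OF ray_pos[OF Suc.prems, of s]] by (auto simp: indicator_def)
  have "generator (Suc k) u \<noteq> 0" if "u \<noteq> 1"
  proof
    assume "generator (Suc k) u = 0"
    then have "AE s in lborel. ?f s = 0"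
      using integral_nonneg_eq_0_iff_AE[OF int(1)] nn int(2) by simp
    then have "AE s in lborel. s \<notin> {0<..1::real}"
    proof eventually_elim
      case (elim s)
      show ?case
      proof
        assume "s \<in> {0<..1}"
        moreover from this have "0 < generator k (1 + s * (u - 1))"
          using Suc.IH[OF ray_pos[OF Suc.prems, of s]] that by auto
        ultimately show False using elim by auto
      qed
    qed
    then have "{0<..1::real} \<in> null_sets lborel"
      by (subst AE_iff_null_sets) auto
    then show False by (simp add: null_sets_def)
  qed
  moreover have "0 \<le> generator (Suc k) u"
    using nn int(2) by (simp add: Bochner_Integration.integral_nonneg)
  ultimately show ?case by auto
qed

lemmas generator_nonneg = generator_nonneg_pos[THEN conjunct1]

lemma generator_eq_0_iff: "0 < u \<Longrightarrow> generator k u = 0 \<longleftrightarrow> u = 1"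
  using generator_nonneg_pos[of u k] by auto

text \<open>
  For order zero the derivative \<open>ln u + 1 - 1 / u\<close> is increasing. The passage to the next order
  averages compositions with the affine maps \<open>u \<mapsto> 1 + s (u - 1)\<close>.
\<close>

lemma generator_convex:
  assumes "0 < x" "0 < y" "l \<in> {0..1}"
  shows "generator k (l * x + (1 - l) * y) \<le> l * generator k x + (1 - l) * generator k y"
  using assms(1,2)
proof (induction k arbitrary: x y)
  case 0
  have "convex_on {0<..} (\<lambda>u::real. (u - 1) * ln u)"
  proof (rule convex_on_realI)
    fix u :: real assume "u \<in> {0<..}"
    then show "((\<lambda>u. (u - 1) * ln u) has_real_derivative ln u + 1 - 1 / u) (at u)"
      by (auto intro!: derivative_eq_intros simp: field_simps)
  next
    fix u v :: real assume "u \<in> {0<..}" "v \<in> {0<..}" "u \<le> v"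
    then show "ln u + 1 - 1 / u \<le> ln v + 1 - 1 / v"
      by (intro diff_mono add_mono) (auto simp: divide_left_mono)
  qed auto
  then have "\<forall>x\<in>{0<..}. \<forall>y\<in>{0<..}. \<forall>u\<ge>0. \<forall>v\<ge>0. u + v = 1 \<longrightarrow>
      generator 0 (u *\<^sub>R x + v *\<^sub>R y) \<le> u * generator 0 x + v * generator 0 y"
    by (simp add: convex_on_def generator_def)
  from this[rule_format, of x y l "1 - l"] show ?case using 0 assms by simp
next
  case (Suc k)
  let ?f = "\<lambda>u s. indicator {0..1} s * (1 / s * generator k (1 + s * (u - 1)))"
  have pos: "0 < l * x + (1 - l) * y"
    using Suc.prems assms(3) by (cases "l = 0") (auto intro!: add_pos_nonneg)
  have hbi: "has_bochner_integral lborel (?f u) (generator (Suc k) u)" if "0 < u" for u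
    using generator_ray_integral[OF that] .
  have "has_bochner_integral lborel (\<lambda>s. l * ?f x s + (1 - l) * ?f y s)
     (l * generator (Suc k) x + (1 - l) * generator (Suc k) y)"
    by (intro has_bochner_integral_add has_bochner_integral_mult_right hbi Suc.prems)
  moreover have "?f (l * x + (1 - l) * y) s \<le> l * ?f x s + (1 - l) * ?f y s" for s
  proof (cases "s \<in> {0..1}")
    case True
    have "1 + s * (l * x + (1 - l) * y - 1) = l * (1 + s * (x - 1)) + (1 - l) * (1 + s * (y - 1))"
      by (simp add: algebra_simps)
    then have "generator k (1 + s * (l * x + (1 - l) * y - 1))
       \<le> l * generator k (1 + s * (x - 1)) + (1 - l) * generator k (1 + s * (y - 1))"
      using Suc.IH[OF ray_pos[OF Suc.prems(1) True] ray_pos[OF Suc.prems(2) True]] by simp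
    from mult_left_mono[OF this, of "1 / s"] show ?thesis
      using True by (simp only: distrib_left mult.left_commute[of "1 / s"]) simp
  qed auto
  ultimately show ?case
    using hbi[OF pos] unfolding has_bochner_integral_iff
    by (metis (no_types, lifting) integral_mono)
qed

text \<open>
  The point \<open>1 + s (u - 1)\<close> lies between \<open>1\<close> and \<open>u\<close>, and the generator vanishes at \<open>1\<close>, so by
  convexity the integrand is at most the generator at \<open>u\<close> for every \<open>s \<in> (0,1]\<close>.
\<close>

lemma generator_Suc_le:
  assumes "0 < u"
  shows "generator (Suc k) u \<le> generator k u"
proof -
  let ?f = "\<lambda>s. indicator {0..1} s * (1 / s * generator k (1 + s * (u - 1)))"
  have "has_bochner_integral lborel (\<lambda>s. indicator {0..1::real} s *\<^sub>R generator k u)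
     (measure lborel {0..1::real} *\<^sub>R generator k u)"
    by (intro has_bochner_integral_scaleR_left has_bochner_integral_real_indicator) auto
  then have "has_bochner_integral lborel (\<lambda>s. indicator {0..1::real} s * generator k u) (generator k u)"
    by simp
  moreover have "?f s \<le> indicator {0..1} s * generator k u" for s
  proof (cases "s \<in> {0<..1}")
    case True
    have "generator k (1 + s * (u - 1)) \<le> s * generator k u"
      using generator_convex[OF assms zero_less_one, of s k] True by (simp add: algebra_simps)
    then show ?thesis using True by (simp add: field_simps)
  next
    case False
    then have "s = 0 \<or> s \<notin> {0..1}" by auto
    then show ?thesis using generator_nonneg[OF assms] by auto
  qed
  ultimately show ?thesis
    using generator_ray_integral[OF assms, of k] unfolding has_bochner_integral_iff
    by (metis (no_types, lifting) integral_mono)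
qed

section \<open>Divergences on a family with common support\<close>

lemma dens_nonneg [simp]: "0 \<le> dens \<mu> P x"
  by (simp add: dens_def)

lemma borel_measurable_dens [measurable]: "dens \<mu> P \<in> borel_measurable \<mu>"
  unfolding dens_def[abs_def] by measurable

text \<open>
  The Radon-Nikodym derivative is a density because some density exists; total mass one makes it
  finite almost everywhere, so truncating it to a real-valued function loses nothing.
\<close>

lemma density_dens_of_density:
  assumes "prob_space P" "f \<in> borel_measurable \<mu>" "P = density \<mu> f"
  shows "density \<mu> (\<lambda>x. ennreal (dens \<mu> P x)) = P"
proof -
  interpret prob_space P by fact
  have RN: "density \<mu> (RN_deriv \<mu> P) = P"
    using assms(2,3) by (metis density_RN_deriv_density)
  have "emeasure (density \<mu> (RN_deriv \<mu> P)) (space \<mu>) = (\<integral>\<^sup>+x. RN_deriv \<mu> P x \<partial>\<mu>)"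
    by (simp add: emeasure_density cong: nn_integral_cong)
  then have "(\<integral>\<^sup>+x. RN_deriv \<mu> P x \<partial>\<mu>) = emeasure P (space P)"
    using RN assms(3) by (metis space_density)
  then have "AE x in \<mu>. RN_deriv \<mu> P x \<noteq> \<infinity>"
    by (intro nn_integral_noteq_infinite) (auto simp: emeasure_space_1)
  then have "density \<mu> (\<lambda>x. ennreal (dens \<mu> P x)) = density \<mu> (RN_deriv \<mu> P)"
    by (intro density_cong) (auto simp: dens_def top.not_eq_extremum)
  with RN show ?thesis by simp
qed

locale common_support_family =
  fixes \<mu> :: "'a measure" and \<P> :: "'a measure set"
  assumes prob: "\<And>P. P \<in> \<P> \<Longrightarrow> prob_space P"
    and has_density: "\<And>P. P \<in> \<P> \<Longrightarrow> \<exists>f\<in>borel_measurable \<mu>. P = density \<mu> f"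
    and common_support:
      "\<And>P Q. P \<in> \<P> \<Longrightarrow> Q \<in> \<P> \<Longrightarrow> AE x in \<mu>. x \<in> supp \<mu> P \<longleftrightarrow> x \<in> supp \<mu> Q"
    and mixtures: "\<And>P Q t. P \<in> \<P> \<Longrightarrow> Q \<in> \<P> \<Longrightarrow> t \<in> {0..1} \<Longrightarrow> mixture P Q t \<in> \<P>"
    and J_finite: "\<And>P Q. P \<in> \<P> \<Longrightarrow> Q \<in> \<P> \<Longrightarrow>
        set_integrable \<mu> (supp \<mu> P \<inter> supp \<mu> Q) (KL_integrand \<mu> P Q) \<and>
        set_integrable \<mu> (supp \<mu> P \<inter> supp \<mu> Q) (KL_integrand \<mu> Q P)"
    and PL_finite: "\<And>j P Q. j \<ge> 1 \<Longrightarrow> P \<in> \<P> \<Longrightarrow> Q \<in> \<P> \<Longrightarrow>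
        set_integrable \<mu> (supp \<mu> P \<inter> supp \<mu> Q) (PL_integrand \<mu> j P Q)"
begin

definition ratio :: "'a measure \<Rightarrow> 'a measure \<Rightarrow> 'a \<Rightarrow> real" where
  "ratio P Q x = dens \<mu> Q x / dens \<mu> P x"

lemma density_dens_eq: "P \<in> \<P> \<Longrightarrow> density \<mu> (\<lambda>x. ennreal (dens \<mu> P x)) = P"
  using has_density density_dens_of_density prob by blast

lemma sets_eq: "P \<in> \<P> \<Longrightarrow> sets P = sets \<mu>"
  using has_density by fastforce

lemma space_eq: "P \<in> \<P> \<Longrightarrow> space P = space \<mu>"
  using sets_eq sets_eq_imp_space_eq by blast

lemma borel_measurable_ratio [measurable]: "ratio P Q \<in> borel_measurable \<mu>"
  unfolding ratio_def[abs_def] by measurable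

lemma measurable_eq: "P \<in> \<P> \<Longrightarrow> borel_measurable P = borel_measurable \<mu>"
  by (intro measurable_cong_sets sets_eq) auto

lemma AE_transfer: "P \<in> \<P> \<Longrightarrow> (AE x in P. S x) \<longleftrightarrow> (AE x in \<mu>. 0 < dens \<mu> P x \<longrightarrow> S x)"
  by (subst density_dens_eq[symmetric]) (auto simp: AE_density)

lemma AE_dens_pos_iff:
  assumes "P \<in> \<P>" "Q \<in> \<P>"
  shows "AE x in \<mu>. 0 < dens \<mu> P x \<longleftrightarrow> 0 < dens \<mu> Q x"
  using common_support[OF assms] AE_space by eventually_elim (auto simp: supp_def)

lemma AE_dens_pos:
  assumes "P \<in> \<P>" "Q \<in> \<P>"
  shows "AE x in P. 0 < dens \<mu> P x \<and> 0 < dens \<mu> Q x"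
  unfolding AE_transfer[OF assms(1)] using AE_dens_pos_iff[OF assms] by eventually_elim auto

lemma AE_ratio_pos:
  assumes "P \<in> \<P>" "Q \<in> \<P>"
  shows "AE x in P. 0 < ratio P Q x"
  using AE_dens_pos[OF assms] by eventually_elim (auto simp: ratio_def)

text \<open>
  Rewriting integrals over the common support as integrals against the probability measure \<open>P\<close>
  puts them in the \<open>\<sigma>\<close>-finite setting of Fubini's theorem.
\<close>

lemma has_integral_over_support:
  fixes f :: "'a \<Rightarrow> real" and g :: "'a \<Rightarrow> real"
  assumes "P \<in> \<P>" "Q \<in> \<P>" and [measurable]: "f \<in> borel_measurable \<mu>" "g \<in> borel_measurable \<mu>"
    and eq: "\<And>x. 0 < dens \<mu> P x \<Longrightarrow> 0 < dens \<mu> Q x \<Longrightarrow> g x = dens \<mu> P x * f x"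
  shows "set_integrable \<mu> (supp \<mu> P \<inter> supp \<mu> Q) g \<longleftrightarrow> integrable P f"
    and "(LINT x:supp \<mu> P \<inter> supp \<mu> Q|\<mu>. g x) = (\<integral>x. f x \<partial>P)"
proof -
  have [measurable]: "supp \<mu> N \<in> sets \<mu>" for N
    unfolding supp_def by measurable
  have AE: "AE x in \<mu>. indicator (supp \<mu> P \<inter> supp \<mu> Q) x *\<^sub>R g x = dens \<mu> P x *\<^sub>R f x"
    using AE_dens_pos_iff[OF assms(1,2)] AE_space
  proof eventually_elim
    case (elim x)
    show ?case
    proof (cases "0 < dens \<mu> P x")
      case True
      then show ?thesis using elim eq[of x] by (auto simp: supp_def)
    next
      case False
      then have "dens \<mu> P x = 0" using dens_nonneg[of \<mu> P x] by linarith
      then show ?thesis by (auto simp: supp_def)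
    qed
  qed
  show "set_integrable \<mu> (supp \<mu> P \<inter> supp \<mu> Q) g \<longleftrightarrow> integrable P f"
  proof -
    have "integrable P f \<longleftrightarrow> integrable (density \<mu> (\<lambda>x. ennreal (dens \<mu> P x))) f"
      by (simp add: density_dens_eq assms(1))
    also have "\<dots> \<longleftrightarrow> integrable \<mu> (\<lambda>x. dens \<mu> P x *\<^sub>R f x)"
      by (rule integrable_density) auto
    also have "\<dots> \<longleftrightarrow> set_integrable \<mu> (supp \<mu> P \<inter> supp \<mu> Q) g"
      unfolding set_integrable_def by (rule integrable_cong_AE[OF _ _ AE, symmetric]) measurable
    finally show ?thesis ..
  qed
  show "(LINT x:supp \<mu> P \<inter> supp \<mu> Q|\<mu>. g x) = (\<integral>x. f x \<partial>P)"
  proof -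
    have "(\<integral>x. f x \<partial>P) = (\<integral>x. f x \<partial>density \<mu> (\<lambda>x. ennreal (dens \<mu> P x)))"
      by (simp add: density_dens_eq assms(1))
    also have "\<dots> = (\<integral>x. dens \<mu> P x *\<^sub>R f x \<partial>\<mu>)"
      by (rule integral_density) auto
    also have "\<dots> = (LINT x:supp \<mu> P \<inter> supp \<mu> Q|\<mu>. g x)"
      unfolding set_lebesgue_integral_def by (rule integral_cong_AE[OF _ _ AE, symmetric]) measurable
    finally show ?thesis ..
  qed
qed

lemma ratio_integral:
  assumes "P \<in> \<P>" "Q \<in> \<P>"
  shows "integrable P (ratio P Q)" "(\<integral>x. ratio P Q x \<partial>P) = 1"
proof -
  interpret Q: prob_space Q using prob assms by blast
  have g: "(\<lambda>_. 1 :: real) \<in> borel_measurable \<mu>" by simp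
  show "integrable P (ratio P Q)"
    using has_integral_over_support(1)[OF assms, of "ratio P Q" "dens \<mu> Q"]
      has_integral_over_support(1)[OF assms(2,1) g, of "dens \<mu> Q"]
    by (simp add: ratio_def Int_commute)
  show "(\<integral>x. ratio P Q x \<partial>P) = 1"
    using has_integral_over_support(2)[OF assms, of "ratio P Q" "dens \<mu> Q"]
      has_integral_over_support(2)[OF assms(2,1) g, of "dens \<mu> Q"]
    by (simp add: ratio_def Int_commute Q.prob_space)
qed

text \<open>
  The two Kullback-Leibler terms have generators \<open>- ln u\<close> and \<open>u ln u\<close>, which add up to
  \<open>(u - 1) ln u\<close>; the term \<open>k (u - 1)\<close> has integral zero.
\<close>

lemma
  assumes P: "P \<in> \<P>" and Q: "Q \<in> \<P>"
  shows integrable_generator: "integrable P (\<lambda>x. generator k (ratio P Q x))"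
    and SL_eq_integral: "SL \<mu> k P Q = (\<integral>x. generator k (ratio P Q x) \<partial>P)"
proof -
  interpret P: prob_space P using prob P by blast
  let ?u = "ratio P Q"
  have KL_PQ: "integrable P (\<lambda>x. - ln (?u x))" "KL \<mu> P Q = (\<integral>x. - ln (?u x) \<partial>P)"
  proof -
    have *: "KL_integrand \<mu> P Q x = dens \<mu> P x * (- ln (?u x))" if "0 < dens \<mu> P x" "0 < dens \<mu> Q x" for x
      using that by (simp add: KL_integrand_def ratio_def ln_div)
    show "integrable P (\<lambda>x. - ln (?u x))"
      using has_integral_over_support(1)[OF P Q _ _ *] J_finite[OF P Q] by (simp add: KL_integrand_def[abs_def])
    show "KL \<mu> P Q = (\<integral>x. - ln (?u x) \<partial>P)"
      unfolding KL_def by (rule has_integral_over_support(2)[OF P Q _ _ *]) (simp_all add: KL_integrand_def[abs_def])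
  qed
  have KL_QP: "integrable P (\<lambda>x. ?u x * ln (?u x))" "KL \<mu> Q P = (\<integral>x. ?u x * ln (?u x) \<partial>P)"
  proof -
    have *: "KL_integrand \<mu> Q P x = dens \<mu> P x * (?u x * ln (?u x))" if "0 < dens \<mu> P x" "0 < dens \<mu> Q x" for x
      using that by (simp add: KL_integrand_def ratio_def)
    show "integrable P (\<lambda>x. ?u x * ln (?u x))"
      using has_integral_over_support(1)[OF P Q _ _ *] J_finite[OF P Q] by (simp add: KL_integrand_def[abs_def])
    show "KL \<mu> Q P = (\<integral>x. ?u x * ln (?u x) \<partial>P)"
      unfolding KL_def Int_commute[of "supp \<mu> Q"]
      by (rule has_integral_over_support(2)[OF P Q _ _ *]) (simp_all add: KL_integrand_def[abs_def])
  qed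
  have PL: "integrable P (\<lambda>x. Li (real j) (1 - ?u x))" "PL \<mu> j P Q = (\<integral>x. Li (real j) (1 - ?u x) \<partial>P)"
    if "j \<ge> 1" for j
  proof -
    have *: "PL_integrand \<mu> j P Q x = dens \<mu> P x * Li (real j) (1 - ?u x)" for x
      by (simp add: PL_integrand_def ratio_def)
    show "integrable P (\<lambda>x. Li (real j) (1 - ?u x))"
      using has_integral_over_support(1)[OF P Q _ _ *] PL_finite[OF that P Q] by (simp add: PL_integrand_def[abs_def])
    show "PL \<mu> j P Q = (\<integral>x. Li (real j) (1 - ?u x) \<partial>P)"
      unfolding PL_def by (rule has_integral_over_support(2)[OF P Q _ _ *]) (simp_all add: PL_integrand_def[abs_def])
  qed
  have "has_bochner_integral P
     (\<lambda>x. (- ln (?u x) + ?u x * ln (?u x)) - (\<Sum>j=1..k. Li (real j) (1 - ?u x)) - real k * (?u x - 1))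
     ((KL \<mu> P Q + KL \<mu> Q P) - (\<Sum>j=1..k. PL \<mu> j P Q) - real k * (1 - 1))"
    using ratio_integral[OF P Q] KL_PQ KL_QP PL P.prob_space
    by (intro has_bochner_integral_diff has_bochner_integral_add has_bochner_integral_sum has_bochner_integral_mult_right)
       (auto simp: has_bochner_integral_iff)
  moreover have "(\<lambda>x. (- ln (?u x) + ?u x * ln (?u x)) - (\<Sum>j=1..k. Li (real j) (1 - ?u x)) - real k * (?u x - 1))
      = (\<lambda>x. generator k (?u x))"
    by (auto simp: generator_def algebra_simps)
  ultimately show "integrable P (\<lambda>x. generator k (ratio P Q x))"
    "SL \<mu> k P Q = (\<integral>x. generator k (ratio P Q x) \<partial>P)"
    by (auto simp: has_bochner_integral_iff SL_def Jeffreys_def)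
qed

text \<open>
  Both functions are densities of the mixture, and densities of a finite measure agree almost
  everywhere.
\<close>

lemma AE_dens_mixture:
  assumes "P \<in> \<P>" "Q \<in> \<P>" "t \<in> {0..1}"
  shows "AE x in \<mu>. dens \<mu> (mixture P Q t) x = (1 - t) * dens \<mu> P x + t * dens \<mu> Q x"
proof -
  let ?M = "mixture P Q t"
  have M: "?M \<in> \<P>" using assms mixtures by blast
  interpret M: prob_space ?M using prob[OF M] .
  have "density \<mu> (\<lambda>x. ennreal (dens \<mu> ?M x))
      = density \<mu> (\<lambda>x. ennreal ((1 - t) * dens \<mu> P x + t * dens \<mu> Q x))"
    unfolding density_dens_eq[OF M]
  proof (rule measure_eqI)
    show "sets ?M = sets (density \<mu> (\<lambda>x. ennreal ((1 - t) * dens \<mu> P x + t * dens \<mu> Q x)))"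
      using sets_eq[OF M] by simp
    fix A assume "A \<in> sets ?M"
    then have A [measurable]: "A \<in> sets \<mu>" using sets_eq[OF M] by simp
    have e: "emeasure N A = (\<integral>\<^sup>+x. ennreal (dens \<mu> N x) * indicator A x \<partial>\<mu>)" if "N \<in> \<P>" for N
      by (subst density_dens_eq[OF that, symmetric]) (simp add: emeasure_density)
    have "emeasure ?M A = ennreal (1 - t) * emeasure P A + ennreal t * emeasure Q A"
      using assms A by (intro emeasure_mixture) (simp_all add: sets_eq)
    also have "\<dots> = (\<integral>\<^sup>+x. ennreal (1 - t) * (ennreal (dens \<mu> P x) * indicator A x)
         + ennreal t * (ennreal (dens \<mu> Q x) * indicator A x) \<partial>\<mu>)"
      by (simp add: e assms nn_integral_add nn_integral_cmult)
    also have "\<dots> = (\<integral>\<^sup>+x. ennreal ((1 - t) * dens \<mu> P x + t * dens \<mu> Q x) * indicator A x \<partial>\<mu>)"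
      using assms(3) by (intro nn_integral_cong) (auto simp: indicator_def ennreal_mult ennreal_plus)
    also have "\<dots> = emeasure (density \<mu> (\<lambda>x. ennreal ((1 - t) * dens \<mu> P x + t * dens \<mu> Q x))) A"
      by (simp add: emeasure_density)
    finally show "emeasure ?M A = emeasure (density \<mu> (\<lambda>x. ennreal ((1 - t) * dens \<mu> P x + t * dens \<mu> Q x))) A" .
  qed
  moreover have "(\<integral>\<^sup>+x. ennreal (dens \<mu> ?M x) \<partial>\<mu>) = emeasure ?M (space ?M)"
    by (subst (2) density_dens_eq[OF M, symmetric])
       (simp add: emeasure_density space_eq[OF M] cong: nn_integral_cong del: space_mixture)
  ultimately have "AE x in \<mu>. ennreal (dens \<mu> ?M x) = ennreal ((1 - t) * dens \<mu> P x + t * dens \<mu> Q x)"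
    by (subst (asm) finite_density_unique) (auto simp: M.emeasure_space_1 simp del: space_mixture)
  then show ?thesis
  proof eventually_elim
    case (elim x)
    moreover have "0 \<le> (1 - t) * dens \<mu> P x + t * dens \<mu> Q x" using assms(3) by simp
    ultimately show ?case by (simp only: ennreal_inj dens_nonneg)
  qed
qed

lemma AE_ratio_mixture:
  assumes "N \<in> \<P>" "P \<in> \<P>" "Q \<in> \<P>" "t \<in> {0..1}"
  shows "AE x in N. ratio N (mixture P Q t) x = (1 - t) * ratio N P x + t * ratio N Q x"
  unfolding AE_transfer[OF assms(1)]
  using AE_dens_mixture[OF assms(2-4)] by eventually_elim (simp add: ratio_def add_divide_distrib)

lemma SL_mixture_ray:
  assumes "P \<in> \<P>" "Q \<in> \<P>" "s \<in> {0..1}"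
  shows "SL \<mu> k P (mixture P Q s) = (\<integral>x. generator k (1 + s * (ratio P Q x - 1)) \<partial>P)"
  unfolding SL_eq_integral[OF assms(1) mixtures[OF assms]]
proof (rule integral_cong_AE)
  show "AE x in P. generator k (ratio P (mixture P Q s) x) = generator k (1 + s * (ratio P Q x - 1))"
    using AE_ratio_mixture[OF assms(1,1,2,3)] AE_dens_pos[OF assms(1,2)]
  proof eventually_elim
    case (elim x)
    then have "ratio P P x = 1" by (simp add: ratio_def)
    with elim have "ratio P (mixture P Q s) x = 1 + s * (ratio P Q x - 1)" by (simp add: algebra_simps)
    then show ?case by simp
  qed
qed (simp_all add: measurable_eq[OF assms(1)])

text \<open>
  For fixed \<open>x\<close> the integrand is nonnegative in \<open>s\<close> and integrates to the next generator. That
  generator is \<open>P\<close>-integrable, so the integrand is integrable on the product and the two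
  integrations may be exchanged.
\<close>

lemma
  assumes P: "P \<in> \<P>" and Q: "Q \<in> \<P>"
  shows Psi_integrable_SL: "Psi_integrable (SL \<mu> k) P Q"
    and Psi_SL: "Psi (SL \<mu> k) P Q = SL \<mu> (Suc k) P Q"
proof -
  interpret P: prob_space P using prob P by blast
  interpret pp: pair_sigma_finite "lborel :: real measure" P ..
  have [measurable]: "ratio P Q \<in> borel_measurable P"
    unfolding measurable_eq[OF P] by (rule borel_measurable_ratio)
  define f where "f s x = indicator {0..1} s * (1 / s * generator k (1 + s * (ratio P Q x - 1)))"
    for s :: real and x
  have f_meas [measurable]: "case_prod f \<in> borel_measurable (lborel \<Otimes>\<^sub>M P)"
    unfolding f_def by measurable
  have nn: "AE x in P. 0 \<le> f s x" for s
    using AE_ratio_pos[OF P Q]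
  proof eventually_elim
    case (elim x)
    show ?case using generator_nonneg[OF ray_pos[OF elim, of s], of k] by (auto simp: f_def indicator_def)
  qed
  have inner: "AE x in P. has_bochner_integral lborel (\<lambda>s. f s x) (generator (Suc k) (ratio P Q x))"
    using AE_ratio_pos[OF P Q] unfolding f_def by eventually_elim (rule generator_ray_integral)
  have int: "integrable (lborel \<Otimes>\<^sub>M P) (case_prod f)"
  proof -
    \<comment> \<open>The factors are swapped because the inner integral that is known is the one over \<open>s\<close>.\<close>
    have "integrable (P \<Otimes>\<^sub>M lborel) (\<lambda>(x, s). f s x)"
    proof (rule pair_sigma_finite.Fubini_integrable)
      show "pair_sigma_finite P (lborel :: real measure)" ..
      show "(\<lambda>(x, s). f s x) \<in> borel_measurable (P \<Otimes>\<^sub>M lborel)" unfolding f_def by measurable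
      show "AE x in P. integrable lborel (\<lambda>s. case (x, s) of (x, s) \<Rightarrow> f s x)"
        using inner by eventually_elim (auto simp: has_bochner_integral_iff)
      have "AE x in P. (LBINT s. norm (f s x)) = generator (Suc k) (ratio P Q x)"
        using inner AE_ratio_pos[OF P Q]
      proof eventually_elim
        case (elim x)
        have "norm (f s x) = f s x" for s
          using generator_nonneg[OF ray_pos[OF elim(2), of s], of k] by (auto simp: f_def indicator_def)
        then show ?case using elim by (simp add: has_bochner_integral_iff)
      qed
      then have "integrable P (\<lambda>x. LBINT s. norm (f s x)) \<longleftrightarrow> integrable P (\<lambda>x. generator (Suc k) (ratio P Q x))"
        by (intro integrable_cong_AE) (auto simp: f_def)
      then show "integrable P (\<lambda>x. LBINT s. norm (case (x, s) of (x, s) \<Rightarrow> f s x))"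
        using integrable_generator[OF P Q] by simp
    qed
    then show ?thesis
      by (subst pp.integrable_product_swap_iff[symmetric]) (simp add: case_prod_beta)
  qed
  have slice: "(\<integral>x. f s x \<partial>P) = indicator {0..1} s *\<^sub>R (1 / s * SL \<mu> k P (mixture P Q s))" for s
    using SL_mixture_ray[OF P Q, of s k] by (cases "s \<in> {0..1}") (simp_all add: f_def)
  show "Psi_integrable (SL \<mu> k) P Q"
    using pp.integrable_fst'[OF int] by (simp add: Psi_integrable_def set_integrable_def slice)
  have "Psi (SL \<mu> k) P Q = (LBINT s. (\<integral>x. f s x \<partial>P))"
    by (simp add: Psi_def set_lebesgue_integral_def slice)
  also have "\<dots> = (\<integral>x. (LBINT s. f s x) \<partial>P)"
    using pp.Fubini_integral[OF int] by simp
  also have "\<dots> = (\<integral>x. generator (Suc k) (ratio P Q x) \<partial>P)"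
    using inner by (intro integral_cong_AE) (auto simp: has_bochner_integral_iff f_def)
  also have "\<dots> = SL \<mu> (Suc k) P Q" by (simp add: SL_eq_integral P Q)
  finally show "Psi (SL \<mu> k) P Q = SL \<mu> (Suc k) P Q" .
qed

text \<open>
  Iterating \<open>\<Psi>\<close> identifies its values only on the family; this suffices, because \<open>\<Psi>\<close> at \<open>(P, Q)\<close>
  looks only at mixtures of \<open>P\<close> and \<open>Q\<close>.
\<close>

lemma Psi_cong:
  assumes "P \<in> \<P>" "Q \<in> \<P>" and eq: "\<And>Q. Q \<in> \<P> \<Longrightarrow> D P Q = D' P Q"
  shows "Psi D P Q = Psi D' P Q" "Psi_integrable D P Q \<longleftrightarrow> Psi_integrable D' P Q"
proof -
  have *: "indicator {0..1} s *\<^sub>R (1 / s * D P (mixture P Q s)) =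
        indicator {0..1} s *\<^sub>R (1 / s * D' P (mixture P Q s))" for s :: real
    using eq[OF mixtures[OF assms(1,2), of s]] by (auto simp: indicator_def)
  show "Psi D P Q = Psi D' P Q" "Psi_integrable D P Q \<longleftrightarrow> Psi_integrable D' P Q"
    unfolding Psi_def Psi_integrable_def set_lebesgue_integral_def set_integrable_def * by simp_all
qed

lemma Psi_funpow_SL:
  assumes "P \<in> \<P>" "Q \<in> \<P>"
  shows "(Psi ^^ k) (SL \<mu> 0) P Q = SL \<mu> k P Q"
  using assms
proof (induction k arbitrary: Q)
  case (Suc k)
  have "(Psi ^^ Suc k) (SL \<mu> 0) P Q = Psi (SL \<mu> k) P Q"
    using Psi_cong(1)[of P Q "(Psi ^^ k) (SL \<mu> 0)" "SL \<mu> k"] Suc by simp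
  then show ?case using Psi_SL Suc.prems by simp
qed simp

lemma SL_nonneg:
  assumes "P \<in> \<P>" "Q \<in> \<P>"
  shows "0 \<le> SL \<mu> k P Q"
  unfolding SL_eq_integral[OF assms] using AE_ratio_pos[OF assms]
  by (intro integral_nonneg_AE) (auto intro: generator_nonneg)

text \<open>
  A nonnegative integrand with integral zero vanishes almost everywhere, and the generators vanish
  only at \<open>1\<close>. Equality of densities on the support extends to all of the space because the
  supports agree.
\<close>

lemma SL_eq_0_iff:
  assumes "P \<in> \<P>" "Q \<in> \<P>"
  shows "SL \<mu> k P Q = 0 \<longleftrightarrow> P = Q"
proof -
  have "SL \<mu> k P Q = 0 \<longleftrightarrow> (AE x in P. generator k (ratio P Q x) = 0)"
    unfolding SL_eq_integral[OF assms]
    using AE_ratio_pos[OF assms]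
    by (intro integral_nonneg_eq_0_iff_AE integrable_generator assms) (auto intro: generator_nonneg)
  also have "\<dots> \<longleftrightarrow> (AE x in P. dens \<mu> Q x = dens \<mu> P x)"
    using AE_dens_pos[OF assms]
    by (intro AE_cong_simp eventually_cong) (auto simp: ratio_def generator_eq_0_iff)
  also have "\<dots> \<longleftrightarrow> P = Q"
  proof
    assume "AE x in P. dens \<mu> Q x = dens \<mu> P x"
    then have "AE x in \<mu>. dens \<mu> P x = dens \<mu> Q x"
      unfolding AE_transfer[OF assms(1)] using AE_dens_pos_iff[OF assms]
    proof eventually_elim
      case (elim x)
      then show ?case using dens_nonneg[of \<mu> P x] dens_nonneg[of \<mu> Q x] by linarith
    qed
    then have "density \<mu> (\<lambda>x. ennreal (dens \<mu> P x)) = density \<mu> (\<lambda>x. ennreal (dens \<mu> Q x))"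
      by (intro density_cong) auto
    then show "P = Q" using assms by (simp add: density_dens_eq)
  qed simp
  finally show ?thesis .
qed

text \<open>
  The density ratio to \<open>P\<close> is affine along mixtures of the second argument.
\<close>

lemma SL_convex:
  assumes P: "P \<in> \<P>" and Q: "Q1 \<in> \<P>" "Q2 \<in> \<P>" and l: "l \<in> {0..1}"
  shows "SL \<mu> k P (mixture Q2 Q1 l) \<le> l * SL \<mu> k P Q1 + (1 - l) * SL \<mu> k P Q2"
proof -
  have M: "mixture Q2 Q1 l \<in> \<P>" using mixtures Q l by blast
  have "SL \<mu> k P (mixture Q2 Q1 l)
      \<le> (\<integral>x. l * generator k (ratio P Q1 x) + (1 - l) * generator k (ratio P Q2 x) \<partial>P)"
    unfolding SL_eq_integral[OF P M]
  proof (rule integral_mono_AE)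
    show "AE x in P. generator k (ratio P (mixture Q2 Q1 l) x)
       \<le> l * generator k (ratio P Q1 x) + (1 - l) * generator k (ratio P Q2 x)"
      using AE_ratio_mixture[OF P Q(2,1) l] AE_ratio_pos[OF P Q(1)] AE_ratio_pos[OF P Q(2)]
    proof eventually_elim
      case (elim x)
      then show ?case using generator_convex[OF elim(2,3) l, of k] by (simp add: add.commute)
    qed
  qed (use P Q M in \<open>auto intro!: integrable_generator\<close>)
  also have "\<dots> = l * SL \<mu> k P Q1 + (1 - l) * SL \<mu> k P Q2"
    using integrable_generator[OF P] Q by (simp add: SL_eq_integral P)
  finally show ?thesis .
qed

lemma SL_Suc_le:
  assumes "P \<in> \<P>" "Q \<in> \<P>"
  shows "SL \<mu> (Suc k) P Q \<le> SL \<mu> k P Q"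
  unfolding SL_eq_integral[OF assms] using AE_ratio_pos[OF assms]
  by (intro integral_mono_AE integrable_generator assms) (auto intro: generator_Suc_le)

end

theorem proposition2:
  fixes \<mu> :: "'a measure" and \<P> :: "'a measure set"
  assumes prob: "\<And>P. P \<in> \<P> \<Longrightarrow> prob_space P"
    and has_density: "\<And>P. P \<in> \<P> \<Longrightarrow> \<exists>f\<in>borel_measurable \<mu>. P = density \<mu> f"
    and common_support:
      "\<And>P Q. P \<in> \<P> \<Longrightarrow> Q \<in> \<P> \<Longrightarrow> AE x in \<mu>. x \<in> supp \<mu> P \<longleftrightarrow> x \<in> supp \<mu> Q"
    and mixtures: "\<And>P Q t. P \<in> \<P> \<Longrightarrow> Q \<in> \<P> \<Longrightarrow> t \<in> {0..1} \<Longrightarrow> mixture P Q t \<in> \<P>"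
    and J_finite: "\<And>P Q. P \<in> \<P> \<Longrightarrow> Q \<in> \<P> \<Longrightarrow>
        set_integrable \<mu> (supp \<mu> P \<inter> supp \<mu> Q) (KL_integrand \<mu> P Q) \<and>
        set_integrable \<mu> (supp \<mu> P \<inter> supp \<mu> Q) (KL_integrand \<mu> Q P)"
    and PL_finite: "\<And>j P Q. j \<ge> 1 \<Longrightarrow> P \<in> \<P> \<Longrightarrow> Q \<in> \<P> \<Longrightarrow>
        set_integrable \<mu> (supp \<mu> P \<inter> supp \<mu> Q) (PL_integrand \<mu> j P Q)"
  shows "(\<forall>k. \<forall>P\<in>\<P>. \<forall>Q\<in>\<P>. Psi_integrable ((Psi ^^ k) (SL \<mu> 0)) P Q) \<and>
    (\<forall>k. \<forall>P\<in>\<P>. \<forall>Q\<in>\<P>. \<forall>t\<in>{0..1}.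
        SL \<mu> k P (mixture P Q t) = (Psi ^^ k) (SL \<mu> 0) P (mixture P Q t)) \<and>
    (\<forall>k\<ge>1. divergence \<P> (\<lambda>P Q. ereal (SL \<mu> k P Q)) \<and>
            right_convex \<P> (\<lambda>P Q. ereal (SL \<mu> k P Q))) \<and>
    (\<forall>P\<in>\<P>. \<forall>Q\<in>\<P>. \<forall>t\<in>{0..1}. decseq (\<lambda>k. SL \<mu> k P (mixture P Q t)))"
proof -
  interpret common_support_family \<mu> \<P>
    by (rule common_support_family.intro) (fact assms)+
  have "Psi_integrable ((Psi ^^ k) (SL \<mu> 0)) P Q" if "P \<in> \<P>" "Q \<in> \<P>" for k P Q
    using Psi_cong(2)[OF that, of "(Psi ^^ k) (SL \<mu> 0)" "SL \<mu> k"] Psi_funpow_SL[OF that(1)]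
      Psi_integrable_SL[OF that] by simp
  moreover have "SL \<mu> k P (mixture P Q t) = (Psi ^^ k) (SL \<mu> 0) P (mixture P Q t)"
    if "P \<in> \<P>" "Q \<in> \<P>" "t \<in> {0..1}" for k P Q t
    using Psi_funpow_SL[OF that(1) mixtures[OF that]] by simp
  moreover have "divergence \<P> (\<lambda>P Q. ereal (SL \<mu> k P Q))" for k
    by (auto simp: divergence_def SL_nonneg SL_eq_0_iff)
  moreover have "right_convex \<P> (\<lambda>P Q. ereal (SL \<mu> k P Q))" for k
    by (auto simp: right_convex_def SL_convex)
  moreover have "decseq (\<lambda>k. SL \<mu> k P (mixture P Q t))" if "P \<in> \<P>" "Q \<in> \<P>" "t \<in> {0..1}" for P Q t
    using SL_Suc_le[OF that(1) mixtures[OF that]] by (rule decseq_SucI)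
  ultimately show ?thesis by blast
qed

end
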